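(* Let $0<\alpha\le 1$, $\beta>0$, $a,b\in\mathbb{R}$, and let $f,g:[0,\infty)\to\mathbb{R}$ be $\alpha$-differentiable at the point $t>0$. Then (in each item, the derivative on the left-hand side exists and the equality holds): 1. (Linearity) $\mathscr{D}_M^{\alpha,\beta}(af+bg)(t)=a\,\mathscr{D}_M^{\alpha,\beta}f(t)+b\,\mathscr{D}_M^{\alpha,\beta}g(t)$. 2. (Product rule) $\mathscr{D}_M^{\alpha,\beta}(f\cdot g)(t)=f(t)\,\mathscr{D}_M^{\alpha,\beta}g(t)+g(t)\,\mathscr{D}_M^{\alpha,\beta}f(t)$. 3. (Quotient rule) If $g(t)\neq 0$, then $\displaystyle \mathscr{D}_M^{\alpha,\beta}\Big(\frac{f}{g}\Big)(t)=\frac{g(t)\,\mathscr{D}_M^{\alpha,\beta}f(t)-f(t)\,\mathscr{D}_M^{\alpha,\beta}g(t)}{[g(t)]^2}$. 4. If $f$ is a constant function $f\equiv c$, then $\mathscr{D}_M^{\alpha,\beta}(c)=0$. 5. If, furthermore, $f$ is differentiable (in the classical sense) at $t$, then $\displaystyle \mathscr{D}_M^{\alpha,\beta}f(t)=\frac{t^{1-\alpha}}{\Gamma(\beta+1)}\,\frac{df(t)}{dt}$. 6. (Chain rule) If $g$ takes values in $[0,\infty)$ and $f$ is differentiable (in the classical sense) at $g(t)$, then $\mathscr{D}_M^{\alpha,\beta}(f\circ g)(t)=f'(g(t))\,\mathscr{D}_M^{\alpha,\beta}g(t)$.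
   Context: For $\beta>0$, $\mathbb{E}_\beta(x)=\sum_{k=0}^\infty \frac{x^k}{\Gamma(\beta k+1)}$ is the one-parameter Mittag-Leffler function. For $0<\alpha\le 1$, $\beta>0$, $t>0$ and a real-valued function $f$ on $[0,\infty)$ (or defined in a neighbourhood of $t$), the local $M$-derivative of order $\alpha$ of $f$ at $t$ is $$\mathscr{D}_M^{\alpha,\beta}f(t)=\lim_{\varepsilon\to 0}\frac{f\big(t\,\mathbb{E}_\beta(\varepsilon t^{-\alpha})\big)-f(t)}{\varepsilon}.$$ $f$ is called $\alpha$-differentiable at $t$ if this (finite) limit exists. *)

theory Defs
  imports "HOL-Analysis.Analysis"
begin

definition mittag_leffler :: "real \<Rightarrow> real \<Rightarrow> real" where
  "mittag_leffler \<beta> x = (\<Sum>k. x ^ k / Gamma (\<beta> * real k + 1))"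

text \<open>
  Functions on $[0,\infty)$ are represented by total functions on the reals. For
  $t > 0$ the argument \<open>t * mittag_leffler \<beta> (\<epsilon> * t powr (- \<alpha>))\<close> tends to \<open>t\<close> as
  \<open>\<epsilon>\<close> tends to 0, so it is eventually positive and the values of \<open>f\<close> on the negative
  reals do not influence the limit.
\<close>

definition M_quotient ::
    "real \<Rightarrow> real \<Rightarrow> (real \<Rightarrow> real) \<Rightarrow> real \<Rightarrow> real \<Rightarrow> real" where
  "M_quotient \<alpha> \<beta> f t \<epsilon> =
     (f (t * mittag_leffler \<beta> (\<epsilon> * t powr (- \<alpha>))) - f t) / \<epsilon>"

definition M_differentiable ::
    "real \<Rightarrow> real \<Rightarrow> (real \<Rightarrow> real) \<Rightarrow> real \<Rightarrow> bool" where
  "M_differentiable \<alpha> \<beta> f t \<longleftrightarrow> (\<exists>L. (M_quotient \<alpha> \<beta> f t \<longlongrightarrow> L) (at 0))"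

definition M_deriv :: "real \<Rightarrow> real \<Rightarrow> (real \<Rightarrow> real) \<Rightarrow> real \<Rightarrow> real" where
  "M_deriv \<alpha> \<beta> f t = Lim (at 0) (M_quotient \<alpha> \<beta> f t)"

end

theory Submission
  imports Defs
begin

text \<open>
  Put \<open>\<phi> \<epsilon> = t E\<^sub>\<beta> (\<epsilon> t\<^sup>-\<^sup>\<alpha>)\<close>. As \<open>\<phi> 0 = t\<close>, the M-derivative of \<open>f\<close> at \<open>t\<close> is the ordinary
  derivative of \<open>f \<circ> \<phi>\<close> at 0, so the algebraic rules and the chain rule are the classical ones.
  The coefficients \<open>1 / \<Gamma>(\<beta> k + 1)\<close> are bounded, hence \<open>E\<^sub>\<beta>\<close> can be differentiated termwise at 0,
  which gives \<open>\<phi>' 0 = t\<^sup>1\<^sup>-\<^sup>\<alpha> / \<Gamma>(\<beta> + 1)\<close>.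
\<close>

text \<open>Each unit shift multiplies \<open>Gamma\<close> by its argument, which is at least 1
  here.\<close>

lemma Gamma_real_add_nat_ge:
  fixes x :: real
  assumes "x \<ge> 1"
  shows "Gamma x \<le> Gamma (x + real n)"
proof (induction n)
  case (Suc n)
  have "x + real n \<notin> \<int>\<^sub>\<le>\<^sub>0"
    using assms by auto
  then have "Gamma (x + real n + 1) = (x + real n) * Gamma (x + real n)"
    by (rule Gamma_plus1)
  moreover have "1 * Gamma (x + real n) \<le> (x + real n) * Gamma (x + real n)"
    using assms by (intro mult_right_mono Gamma_real_nonneg) auto
  ultimately show ?case
    using Suc.IH by (simp add: algebra_simps)
qed simp

text \<open>Compactness gives a positive minimum on \<open>{1..2}\<close>, and integer shifts carry
  it to the whole half-line. Its reciprocal bounds all Mittag-Leffler coefficients at once.\<close>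

lemma Gamma_real_lower_bound:
  obtains m :: real where "m > 0" and "\<And>x. x \<ge> 1 \<Longrightarrow> m \<le> Gamma x"
proof -
  have "continuous_on {1..2::real} Gamma"
    by (intro continuous_intros) auto
  then obtain y where y: "y \<in> {1..2::real}" "\<And>x. x \<in> {1..2} \<Longrightarrow> Gamma y \<le> Gamma x"
    using continuous_attains_inf[of "{1..2::real}" Gamma] by auto
  show ?thesis
  proof (rule that)
    show "0 < Gamma y"
      using y(1) by (intro Gamma_real_pos) auto
  next
    fix x :: real
    assume "x \<ge> 1"
    \<comment> \<open>Subtracting the integer part of \<open>x - 1\<close> moves \<open>x\<close>
      into the interval from 1 to 2, where \<open>y\<close> is the minimiser.\<close>
    define n where "n = nat \<lfloor>x - 1\<rfloor>"
    have n: "real n = of_int \<lfloor>x - 1\<rfloor>"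
      using \<open>x \<ge> 1\<close> by (simp add: n_def)
    have "1 \<le> x - real n" "x - real n \<le> 2"
      unfolding n by linarith+
    then have "Gamma y \<le> Gamma (x - real n)"
      by (intro y(2)) auto
    also have "\<dots> \<le> Gamma (x - real n + real n)"
      using \<open>1 \<le> x - real n\<close> by (rule Gamma_real_add_nat_ge)
    finally show "Gamma y \<le> Gamma x"
      by simp
  qed
qed

text \<open>A geometric series dominates, the coefficients being at most \<open>1 / m\<close>.
  Convergence on the unit interval suffices, because the series is differentiated only at 0.\<close>

lemma summable_mittag_leffler:
  fixes \<beta> x :: real
  assumes "\<beta> \<ge> 0" and "\<bar>x\<bar> < 1"
  shows "summable (\<lambda>k. 1 / Gamma (\<beta> * real k + 1) * x ^ k)"
proof -
  obtain m :: real where m: "m > 0" "\<And>x. x \<ge> 1 \<Longrightarrow> m \<le> Gamma x"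
    using Gamma_real_lower_bound by blast
  show ?thesis
  proof (rule summable_comparison_test')
    show "summable (\<lambda>k. 1 / m * \<bar>x\<bar> ^ k)"
      using assms by (intro summable_mult summable_geometric) auto
  next
    fix k :: nat
    have "m \<le> Gamma (\<beta> * real k + 1)"
      using assms by (intro m) auto
    then have "1 / Gamma (\<beta> * real k + 1) \<le> 1 / m" "0 < Gamma (\<beta> * real k + 1)"
      using m(1) by (auto simp: frac_le)
    then have "1 / Gamma (\<beta> * real k + 1) * \<bar>x\<bar> ^ k \<le> 1 / m * \<bar>x\<bar> ^ k"
      by (intro mult_right_mono) auto
    then show "norm (1 / Gamma (\<beta> * real k + 1) * x ^ k) \<le> 1 / m * \<bar>x\<bar> ^ k"
      using \<open>0 < Gamma (\<beta> * real k + 1)\<close> by (simp add: abs_mult power_abs)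
  qed
qed

lemma mittag_leffler_0 [simp]: "mittag_leffler \<beta> 0 = 1"
  using powser_zero[of "\<lambda>k. 1 / Gamma (\<beta> * real k + 1)"]
  by (simp add: mittag_leffler_def)

lemma DERIV_mittag_leffler_0:
  assumes "\<beta> \<ge> 0"
  shows "(mittag_leffler \<beta> has_real_derivative 1 / Gamma (\<beta> + 1)) (at 0)"
proof -
  define c where "c = (\<lambda>k. 1 / Gamma (\<beta> * real k + 1))"
  \<comment> \<open>Termwise differentiation at 0 asks for convergence at some point of larger
    modulus; \<open>1 / 2\<close> serves as that point.\<close>
  have "summable (\<lambda>k. c k * (1 / 2) ^ k)"
    unfolding c_def using assms by (intro summable_mittag_leffler) auto
  then have "((\<lambda>x. \<Sum>k. c k * x ^ k) has_real_derivative (\<Sum>k. diffs c k * 0 ^ k)) (at 0)"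
    by (rule termdiffs_strong) simp
  moreover have "(\<lambda>x. \<Sum>k. c k * x ^ k) = mittag_leffler \<beta>"
    by (simp add: fun_eq_iff mittag_leffler_def c_def)
  moreover have "(\<Sum>k. diffs c k * 0 ^ k) = 1 / Gamma (\<beta> + 1)"
    by (subst powser_zero) (simp add: diffs_def c_def)
  ultimately show ?thesis
    by simp
qed

definition M_path :: "real \<Rightarrow> real \<Rightarrow> real \<Rightarrow> real \<Rightarrow> real" where
  "M_path \<alpha> \<beta> t \<epsilon> = t * mittag_leffler \<beta> (\<epsilon> * t powr (- \<alpha>))"

lemma M_path_0 [simp]: "M_path \<alpha> \<beta> t 0 = t"
  by (simp add: M_path_def)

text \<open>The inner scaling contributes \<open>t powr (- \<alpha>)\<close> and the outer factor
  \<open>t\<close> raises the exponent to \<open>1 - \<alpha>\<close>.\<close>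

lemma DERIV_M_path:
  assumes "\<beta> \<ge> 0" and "t > 0"
  shows "(M_path \<alpha> \<beta> t has_real_derivative t powr (1 - \<alpha>) / Gamma (\<beta> + 1)) (at 0)"
proof -
  have "((\<lambda>\<epsilon>. \<epsilon> * t powr (- \<alpha>)) has_real_derivative t powr (- \<alpha>)) (at 0)"
    by (auto intro!: derivative_eq_intros)
  with DERIV_mittag_leffler_0[OF assms(1)]
  have "((\<lambda>\<epsilon>. mittag_leffler \<beta> (\<epsilon> * t powr (- \<alpha>))) has_real_derivative
      1 / Gamma (\<beta> + 1) * t powr (- \<alpha>)) (at 0)"
    by (intro DERIV_chain2[where f = "mittag_leffler \<beta>"]) auto
  then have "(M_path \<alpha> \<beta> t has_real_derivative
      t * (1 / Gamma (\<beta> + 1) * t powr (- \<alpha>))) (at 0)"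
    unfolding M_path_def by (rule DERIV_cmult)
  moreover have "t powr (1 - \<alpha>) = t * t powr (- \<alpha>)"
    using assms(2) by (simp add: powr_diff powr_minus divide_inverse)
  ultimately show ?thesis
    by simp
qed

text \<open>This is the bridge to classical calculus: since the path starts at \<open>t\<close>,
  \<open>M_quotient\<close> is literally the difference quotient at 0 of \<open>f\<close> along the
  path.\<close>

lemma M_quotient_tendsto_iff:
  "(M_quotient \<alpha> \<beta> f t \<longlongrightarrow> L) (at 0) \<longleftrightarrow>
    ((\<lambda>\<epsilon>. f (M_path \<alpha> \<beta> t \<epsilon>)) has_real_derivative L) (at 0)"
proof -
  \<comment> \<open>The form \<open>0 + \<epsilon>\<close> matches the difference quotient in
    \<open>DERIV_def\<close>.\<close>
  have "M_quotient \<alpha> \<beta> f t =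
      (\<lambda>\<epsilon>. (f (M_path \<alpha> \<beta> t (0 + \<epsilon>)) - f (M_path \<alpha> \<beta> t 0)) / \<epsilon>)"
    by (simp add: fun_eq_iff M_quotient_def M_path_def)
  then show ?thesis
    by (simp only: DERIV_def)
qed

lemma M_differentiable_imp_DERIV:
  assumes "M_differentiable \<alpha> \<beta> f t"
  shows "((\<lambda>\<epsilon>. f (M_path \<alpha> \<beta> t \<epsilon>)) has_real_derivative M_deriv \<alpha> \<beta> f t) (at 0)"
proof -
  obtain L where L: "(M_quotient \<alpha> \<beta> f t \<longlongrightarrow> L) (at 0)"
    using assms by (auto simp: M_differentiable_def)
  moreover have "M_deriv \<alpha> \<beta> f t = L"
    unfolding M_deriv_def using L by (intro tendsto_Lim) auto
  ultimately show ?thesis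
    by (simp add: M_quotient_tendsto_iff)
qed

lemma DERIV_imp_M_deriv:
  assumes "((\<lambda>\<epsilon>. f (M_path \<alpha> \<beta> t \<epsilon>)) has_real_derivative L) (at 0)"
  shows "M_differentiable \<alpha> \<beta> f t \<and> M_deriv \<alpha> \<beta> f t = L"
proof -
  have "(M_quotient \<alpha> \<beta> f t \<longlongrightarrow> L) (at 0)"
    using assms by (simp add: M_quotient_tendsto_iff)
  then show ?thesis
    unfolding M_differentiable_def M_deriv_def by (auto intro: tendsto_Lim)
qed

text \<open>The derivative of \<open>f\<close> is taken within \<open>{0..}\<close>, so it is
  one-sided if \<open>g t = 0\<close>. The inner values must therefore stay nonnegative, which holds
  while the path is positive, hence near 0. Stating the inner derivative along the path as a free
  \<open>L\<close> lets the lemma serve for the identity as well as for an M-differentiable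
  \<open>g\<close>.\<close>

lemma M_deriv_chain:
  assumes "\<beta> \<ge> 0" and "t > 0"
    and "((\<lambda>\<epsilon>. g (M_path \<alpha> \<beta> t \<epsilon>)) has_real_derivative L) (at 0)"
    and g: "\<forall>x\<ge>0. g x \<ge> 0"
    and f: "(f has_real_derivative D) (at (g t) within {0..})"
  shows "M_differentiable \<alpha> \<beta> (\<lambda>x. f (g x)) t \<and> M_deriv \<alpha> \<beta> (\<lambda>x. f (g x)) t = D * L"
proof -
  have "isCont (M_path \<alpha> \<beta> t) 0"
    using DERIV_M_path[OF assms(1,2)] by (rule DERIV_isCont)
  then have "(M_path \<alpha> \<beta> t \<longlongrightarrow> t) (nhds 0)"
    by (simp add: continuous_at tendsto_nhds_iff)
  then have "\<forall>\<^sub>F \<epsilon> in nhds 0. M_path \<alpha> \<beta> t \<epsilon> > 0"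
    using \<open>t > 0\<close> by (rule order_tendstoD)
  then obtain U where U: "open U" "0 \<in> U" "\<And>\<epsilon>. \<epsilon> \<in> U \<Longrightarrow> M_path \<alpha> \<beta> t \<epsilon> > 0"
    by (auto simp: eventually_nhds)
  have "(\<lambda>\<epsilon>. g (M_path \<alpha> \<beta> t \<epsilon>)) ` U \<subseteq> {0..}"
    using U(3) g by (auto simp: less_imp_le)
  with f have "(f has_real_derivative D) (at (g t) within (\<lambda>\<epsilon>. g (M_path \<alpha> \<beta> t \<epsilon>)) ` U)"
    by (rule DERIV_subset)
  moreover have "((\<lambda>\<epsilon>. g (M_path \<alpha> \<beta> t \<epsilon>)) has_real_derivative L) (at 0 within U)"
    using assms(3) by (rule has_field_derivative_at_within)
  ultimately have "(f \<circ> (\<lambda>\<epsilon>. g (M_path \<alpha> \<beta> t \<epsilon>)) has_real_derivative D * L) (at 0 within U)"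
    using DERIV_image_chain[of f D "\<lambda>\<epsilon>. g (M_path \<alpha> \<beta> t \<epsilon>)" 0 U L] by simp
  \<comment> \<open>As \<open>U\<close> is an open neighbourhood of 0, the derivative within
    \<open>U\<close> is a full two-sided derivative.\<close>
  then show ?thesis
    by (intro DERIV_imp_M_deriv) (simp add: at_within_open[OF U(2,1)] o_def)
qed

theorem theorem2:
  fixes \<alpha> \<beta> a b t :: real and f g :: "real \<Rightarrow> real"
  assumes "0 < \<alpha>" and "\<alpha> \<le> 1" and "0 < \<beta>" and "0 < t"
    and "M_differentiable \<alpha> \<beta> f t" and "M_differentiable \<alpha> \<beta> g t"
  shows
    "(M_differentiable \<alpha> \<beta> (\<lambda>x. a * f x + b * g x) t \<and>
      M_deriv \<alpha> \<beta> (\<lambda>x. a * f x + b * g x) t =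
        a * M_deriv \<alpha> \<beta> f t + b * M_deriv \<alpha> \<beta> g t) \<and>
     (M_differentiable \<alpha> \<beta> (\<lambda>x. f x * g x) t \<and>
      M_deriv \<alpha> \<beta> (\<lambda>x. f x * g x) t =
        f t * M_deriv \<alpha> \<beta> g t + g t * M_deriv \<alpha> \<beta> f t) \<and>
     (g t \<noteq> 0 \<longrightarrow>
      M_differentiable \<alpha> \<beta> (\<lambda>x. f x / g x) t \<and>
      M_deriv \<alpha> \<beta> (\<lambda>x. f x / g x) t =
        (g t * M_deriv \<alpha> \<beta> f t - f t * M_deriv \<alpha> \<beta> g t) / (g t)\<^sup>2) \<and>
     (\<forall>c. (\<forall>x\<ge>0. f x = c) \<longrightarrow>
      M_differentiable \<alpha> \<beta> f t \<and> M_deriv \<alpha> \<beta> f t = 0) \<and>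
     (\<forall>D. (f has_real_derivative D) (at t within {0..}) \<longrightarrow>
      M_differentiable \<alpha> \<beta> f t \<and>
      M_deriv \<alpha> \<beta> f t = t powr (1 - \<alpha>) / Gamma (\<beta> + 1) * D) \<and>
     (\<forall>D. (\<forall>x\<ge>0. g x \<ge> 0) \<longrightarrow> (f has_real_derivative D) (at (g t) within {0..}) \<longrightarrow>
      M_differentiable \<alpha> \<beta> (\<lambda>x. f (g x)) t \<and>
      M_deriv \<alpha> \<beta> (\<lambda>x. f (g x)) t = D * M_deriv \<alpha> \<beta> g t)"
proof -
  let ?p = "M_path \<alpha> \<beta> t"
  have f: "((\<lambda>\<epsilon>. f (?p \<epsilon>)) has_real_derivative M_deriv \<alpha> \<beta> f t) (at 0)"
    and g: "((\<lambda>\<epsilon>. g (?p \<epsilon>)) has_real_derivative M_deriv \<alpha> \<beta> g t) (at 0)"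
    using assms(5,6) by (auto intro: M_differentiable_imp_DERIV)
  have linear: "M_differentiable \<alpha> \<beta> (\<lambda>x. a * f x + b * g x) t \<and>
      M_deriv \<alpha> \<beta> (\<lambda>x. a * f x + b * g x) t = a * M_deriv \<alpha> \<beta> f t + b * M_deriv \<alpha> \<beta> g t"
    by (rule DERIV_imp_M_deriv[OF DERIV_add[OF DERIV_cmult[OF f] DERIV_cmult[OF g]]])
  have product: "M_differentiable \<alpha> \<beta> (\<lambda>x. f x * g x) t \<and>
      M_deriv \<alpha> \<beta> (\<lambda>x. f x * g x) t = f t * M_deriv \<alpha> \<beta> g t + g t * M_deriv \<alpha> \<beta> f t"
    using DERIV_mult[OF f g] by (intro DERIV_imp_M_deriv) (simp add: algebra_simps)
  have quotient: "M_differentiable \<alpha> \<beta> (\<lambda>x. f x / g x) t \<and>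
      M_deriv \<alpha> \<beta> (\<lambda>x. f x / g x) t =
        (g t * M_deriv \<alpha> \<beta> f t - f t * M_deriv \<alpha> \<beta> g t) / (g t)\<^sup>2" if "g t \<noteq> 0"
    using DERIV_divide[OF f g] that
    by (intro DERIV_imp_M_deriv) (simp add: algebra_simps power2_eq_square)
  \<comment> \<open>This is the chain rule with the identity as inner function, whose derivative
    along the path is that of \<open>M_path\<close> itself.\<close>
  have classical: "M_differentiable \<alpha> \<beta> f t \<and>
      M_deriv \<alpha> \<beta> f t = t powr (1 - \<alpha>) / Gamma (\<beta> + 1) * D"
    if "(f has_real_derivative D) (at t within {0..})" for D
  proof -
    have "M_differentiable \<alpha> \<beta> (\<lambda>x. f x) t \<and>
        M_deriv \<alpha> \<beta> (\<lambda>x. f x) t = D * (t powr (1 - \<alpha>) / Gamma (\<beta> + 1))"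
      using assms(3,4) that by (intro M_deriv_chain[where g = "\<lambda>x. x"] DERIV_M_path) auto
    then show ?thesis
      by (simp only: mult.commute)
  qed
  \<comment> \<open>The values of \<open>f\<close> on negative reals are arbitrary, but its
    derivative within \<open>{0..}\<close> is 0, so the classical case applies.\<close>
  have const: "M_differentiable \<alpha> \<beta> f t \<and> M_deriv \<alpha> \<beta> f t = 0" if "\<forall>x\<ge>0. f x = c" for c
  proof -
    have "(f has_real_derivative 0) (at t within {0..})"
      using that assms(4)
      by (intro has_field_derivative_transform_within[OF DERIV_const[of c] zero_less_one]) auto
    from classical[OF this] show ?thesis
      by simp
  qed
  have chain: "M_differentiable \<alpha> \<beta> (\<lambda>x. f (g x)) t \<and>
      M_deriv \<alpha> \<beta> (\<lambda>x. f (g x)) t = D * M_deriv \<alpha> \<beta> g t"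
    if "\<forall>x\<ge>0. g x \<ge> 0" "(f has_real_derivative D) (at (g t) within {0..})" for D
    using M_deriv_chain[OF _ assms(4) g that] assms(3) by simp
  show ?thesis
    by (intro conjI[OF linear] conjI[OF product] conjI;
        (rule impI, erule quotient | rule allI, rule impI, erule const |
         rule allI, rule impI, erule classical | rule allI, rule impI, rule impI, erule (1) chain))
qed

end
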